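(* Let $P$ be a bounded and graded poset of rank $n$ with an EL-labeling $\lambda:\mathcal E(P)\to\Lambda$, and let $t\ge1$. For every $J\subseteq[n-1]$: (1) $(-1)^{|J|-1}\mu(P_J)=\sum_{\sigma\in w_n(\Lambda),\ \mathrm{Des}(\sigma)=J} e\ell_\lambda(\sigma)$; in particular $(-1)^{n-2}\mu(P)=\sum_{\sigma\in w_n(\Lambda),\ \mathrm{Des}(\sigma)=[n-1]} e\ell_\lambda(\sigma)$. (2) $(-1)^{|J|-1}\mu(P^{(t)}_J)=\sum_{(\sigma^1,\ldots,\sigma^t)\in w_n(\Lambda)^{\times t},\ \mathrm{Des}((\sigma^1,\ldots,\sigma^t))=J}\ \prod_{i=1}^t e\ell_\lambda(\sigma^i)$; in particular $(-1)^{n-2}\mu(P^{(t)})=\sum \prod_{i=1}^t e\ell_\lambda(\sigma^i)$, the sum over all $(\sigma^1,\ldots,\sigma^t)\in w_n(\Lambda)^{\times t}$ such that $\sigma^1,\ldots,\sigma^t$ have no common ascent.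
   Context: A poset is bounded if it has least and greatest elements $\hat0,\hat1$, graded if all maximal chains in any interval have the same length; $\mathrm{rk}$ is the rank function and the rank of $P$ is $\mathrm{rk}(\hat1)$. An edge labeling is a map $\lambda$ from the set $\mathcal E(P)$ of cover relations to a poset $\Lambda$; a maximal chain $\hat0=x_0\lessdot x_1\lessdot\cdots\lessdot x_n=\hat1$ has label word $\lambda(x_0,x_1)\cdots\lambda(x_{n-1},x_n)$. $\lambda$ is an EL-labeling if in every interval $[x,y]$ there is a unique maximal chain whose labels strictly increase, and its label word lexicographically strictly precedes that of every other maximal chain in $[x,y]$. $w_n(\Lambda)$ is the set of words of length $n$ over $\Lambda$, $w_n(\Lambda)^{\times t}$ its $t$-fold Cartesian product, and $e\ell_\lambda(\sigma)$ is the number of maximal chains $c$ of $P$ with label word $\sigma$. For a word $w_1\cdots w_n$, $\mathrm{Asc}=\{i\in[n-1]:w_i<w_{i+1}\}$ and $\mathrm{Des}=[n-1]\setminus\mathrm{Asc}$; for a tuple $(\sigma^1,\ldots,\sigma^t)$ of words, $\mathrm{Des}((\sigma^1,\ldots,\sigma^t))=[n-1]\setminus\bigcap_i\mathrm{Asc}(\sigma^i)$ (the descent set of the word over the product poset $\Lambda^t$ whose $i$th letter is $(\sigma^1_i,\ldots,\sigma^t_i)$). The $t$-fold Segre power $P^{(t)}$ ($t\ge2$) is the induced subposet of $P\times\cdots\times P$ ($t$ factors, componentwise order) of tuples whose entries all have equal rank; $P^{(1)}=P$. For $J\subseteq[n-1]$ and a bounded graded poset $Q$ of rank $n$, $Q_J$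 is the subposet of elements with rank in $J$ together with $\hat0,\hat1$, and $\mu(Q_J)$ denotes the Möbius function value $\mu_{Q_J}(\hat0,\hat1)$; $\mu(Q)=\mu_Q(\hat0,\hat1)$. *)

theory Defs
  imports "HOL-Analysis.Infinite_Sum" "HOL-Library.FuncSet"
begin

(* A poset is a carrier set Q in a type of class order, with the order of the type;
   induced subposets are subsets.  Its bounds are (LEAST x. x \<in> Q) and
   (GREATEST x. x \<in> Q). *)

definition bounded_poset :: "'a::order set \<Rightarrow> bool" where
  "bounded_poset Q \<longleftrightarrow> (\<exists>b\<in>Q. \<forall>x\<in>Q. b \<le> x) \<and> (\<exists>u\<in>Q. \<forall>x\<in>Q. x \<le> u)"

definition zero_hat :: "'a::order set \<Rightarrow> 'a" where
  "zero_hat Q = (LEAST x. x \<in> Q)"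

definition one_hat :: "'a::order set \<Rightarrow> 'a" where
  "one_hat Q = (GREATEST x. x \<in> Q)"

definition covers :: "'a::order set \<Rightarrow> 'a \<Rightarrow> 'a \<Rightarrow> bool" where
  "covers Q x y \<longleftrightarrow> x \<in> Q \<and> y \<in> Q \<and> x < y \<and> \<not> (\<exists>z\<in>Q. x < z \<and> z < y)"

definition cover_relations :: "'a::order set \<Rightarrow> ('a \<times> 'a) set" where
  "cover_relations Q = {(x, y). covers Q x y}"

(* The maximal chains of the interval [x, y] of Q, as lists x = x_0, x_1, ..., x_k = y
   of successive covers; the length of the chain in the sense of posets is k, one less than
   the length of the list. *)
definition interval_max_chains :: "'a::order set \<Rightarrow> 'a \<Rightarrow> 'a \<Rightarrow> 'a list set" where
  "interval_max_chains Q x y =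
     {c. c \<noteq> [] \<and> set c \<subseteq> Q \<and> hd c = x \<and> last c = y \<and> successively (covers Q) c}"

definition graded_poset :: "'a::order set \<Rightarrow> bool" where
  "graded_poset Q \<longleftrightarrow>
     (\<forall>x\<in>Q. \<forall>y\<in>Q. \<forall>c\<in>interval_max_chains Q x y. \<forall>d\<in>interval_max_chains Q x y.
        length c = length d)"

definition rk :: "'a::order set \<Rightarrow> 'a \<Rightarrow> nat" where
  "rk Q x = (THE k. \<exists>c\<in>interval_max_chains Q (zero_hat Q) x. length c = Suc k)"

definition poset_rank :: "'a::order set \<Rightarrow> nat" where
  "poset_rank Q = rk Q (one_hat Q)"

definition max_chains :: "'a::order set \<Rightarrow> 'a list set" where
  "max_chains Q = interval_max_chains Q (zero_hat Q) (one_hat Q)"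

definition rank_selected :: "'a::order set \<Rightarrow> nat set \<Rightarrow> 'a set" where
  "rank_selected Q J = {x \<in> Q. rk Q x \<in> J} \<union> {zero_hat Q, one_hat Q}"

(* The usual recursion for the Moebius function of a locally finite poset; the finiteness
   test only makes the recursion terminate on arbitrary sets. *)
function moebius :: "'a::order set \<Rightarrow> 'a \<Rightarrow> 'a \<Rightarrow> int" where
  "moebius Q x y =
     (if x = y then 1
      else if x < y \<and> finite {z \<in> Q. x \<le> z \<and> z < y}
      then - (\<Sum>z\<in>{z \<in> Q. x \<le> z \<and> z < y}. moebius Q x z)
      else 0)"
  by auto
termination
proof (relation "measure (\<lambda>(Q, x, y). card {z \<in> Q. x \<le> z \<and> z < y})", goal_cases)
  case 1
  show ?case by simp
next
  case (2 Q x y z)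
  then have "{w \<in> Q. x \<le> w \<and> w < z} \<subset> {w \<in> Q. x \<le> w \<and> w < y}"
    by (auto intro: less_trans)
  with 2 show ?case
    by (simp add: psubset_card_mono)
qed

declare moebius.simps [simp del]

definition mu :: "'a::order set \<Rightarrow> int" where
  "mu Q = moebius Q (zero_hat Q) (one_hat Q)"

definition label_word :: "('a \<times> 'a \<Rightarrow> 'l) \<Rightarrow> 'a list \<Rightarrow> 'l list" where
  "label_word lam c = map lam (zip c (tl c))"

definition EL_labeling ::
  "'a::order set \<Rightarrow> 'l::order set \<Rightarrow> ('a \<times> 'a \<Rightarrow> 'l) \<Rightarrow> bool" where
  "EL_labeling Q L lam \<longleftrightarrow>
     lam \<in> cover_relations Q \<rightarrow> L \<and>
     (\<forall>x\<in>Q. \<forall>y\<in>Q. x \<le> y \<longrightarrow>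
        (\<exists>!c. c \<in> interval_max_chains Q x y \<and> sorted_wrt (<) (label_word lam c)) \<and>
        (\<forall>c\<in>interval_max_chains Q x y. \<forall>d\<in>interval_max_chains Q x y.
           sorted_wrt (<) (label_word lam c) \<and> d \<noteq> c \<longrightarrow>
           (label_word lam c, label_word lam d) \<in> lex {(a, b). a < b}))"

definition words :: "nat \<Rightarrow> 'l set \<Rightarrow> 'l list set" where
  "words n L = {w. set w \<subseteq> L \<and> length w = n}"

definition el :: "'a::order set \<Rightarrow> ('a \<times> 'a \<Rightarrow> 'l) \<Rightarrow> 'l list \<Rightarrow> nat" where
  "el Q lam w = card {c \<in> max_chains Q. label_word lam c = w}"

(* Positions in a word are counted from 1, hence the shift against the list index. *)
definition Asc :: "'l::order list \<Rightarrow> nat set" where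
  "Asc w = {i \<in> {1..length w - 1}. w ! (i - 1) < w ! i}"

definition Des :: "'l::order list \<Rightarrow> nat set" where
  "Des w = {1..length w - 1} - Asc w"

(* t-tuples are functions on {1..t}, extended by undefined outside. *)

definition Des_tuple :: "nat \<Rightarrow> nat \<Rightarrow> (nat \<Rightarrow> 'l::order list) \<Rightarrow> nat set" where
  "Des_tuple n t ws = {1..n - 1} - (\<Inter>i\<in>{1..t}. Asc (ws i))"

(* The order of the function type is pointwise; on these tuples it is the componentwise order
   of the t-fold product.  For t = 1 this is a copy of Q. *)
definition segre_power :: "'a::order set \<Rightarrow> nat \<Rightarrow> (nat \<Rightarrow> 'a) set" where
  "segre_power Q t =
     {x \<in> {1..t} \<rightarrow>\<^sub>E Q. \<forall>i\<in>{1..t}. \<forall>j\<in>{1..t}. rk Q (x i) = rk Q (x j)}"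

(* Since the set of labels may be infinite, sums over words are written with infsum.
   For a finite poset only finitely many terms are nonzero. *)
lemma finite_interval_max_chains:
  assumes "finite Q"
  shows "finite (interval_max_chains Q x y)"
proof -
  have "distinct c" if "successively (covers Q) c" for c
  proof -
    have "successively (<) c"
      using that by (rule successively_mono) (auto simp: covers_def)
    then have "sorted_wrt (<) c"
      by (simp add: successively_conv_sorted_wrt)
    then show ?thesis
      by (induction c) auto
  qed
  then have "interval_max_chains Q x y \<subseteq> {c. set c \<subseteq> Q \<and> distinct c}"
    by (auto simp: interval_max_chains_def)
  then show ?thesis
    using finite_subset_distinct[OF assms] finite_subset by blast
qed

lemma finite_el_support:
  assumes "finite Q"
  shows "finite {w. el Q lam w \<noteq> 0}"
proof (rule finite_subset)
  show "{w. el Q lam w \<noteq> 0} \<subseteq> label_word lam ` max_chains Q"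
    by (auto simp: el_def card_eq_0_iff)
  show "finite (label_word lam ` max_chains Q)"
    by (simp add: assms max_chains_def finite_interval_max_chains)
qed

end

(* For j in J, cutting a maximal chain at rank j and refilling the upper part by the unique
   increasing chain shows that the chains up to elements of rank j with descent set K are as
   many as the chains up to the top with descent set K or K \<union> {j}.  Inserted into the recursion
   of the Moebius function, these counts telescope.  The argument needs no labels, only a
   predicate saying at which triples of consecutive elements a chain ascends.  It therefore
   applies to the Segre power as well, whose maximal chains are tuples of maximal chains of P
   and ascend where all components ascend. *)

theory Submission
  imports Defs
begin

section \<open>Joining and cutting maximal chains; the bounds of a poset\<close>

lemma interval_max_chains_append:
  assumes "c \<in> interval_max_chains Q x y" "d \<in> interval_max_chains Q y z"
  shows "c @ tl d \<in> interval_max_chains Q x z"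
  using assms by (cases d) (auto simp: interval_max_chains_def successively_append_iff successively_Cons)

lemma interval_max_chains_nth:
  assumes "c \<in> interval_max_chains Q x y" "i < length c"
  shows "c ! i \<in> Q"
  using assms by (auto simp: interval_max_chains_def)

lemma interval_max_chains_iff_nth:
  "c \<in> interval_max_chains Q x y \<longleftrightarrow>
     c \<noteq> [] \<and> (\<forall>i<length c. c ! i \<in> Q) \<and> c ! 0 = x \<and> c ! (length c - 1) = y \<and>
     (\<forall>i. Suc i < length c \<longrightarrow> covers Q (c ! i) (c ! Suc i))"
  by (auto simp: interval_max_chains_def successively_conv_nth hd_conv_nth last_conv_nth
      in_set_conv_nth subset_iff)

lemma interval_max_chains_take:
  assumes "c \<in> interval_max_chains Q x y" "i < length c"
  shows "take (Suc i) c \<in> interval_max_chains Q x (c ! i)"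
proof -
  have "length (take (Suc i) c) = Suc i" using assms by simp
  then show ?thesis using assms by (auto simp: interval_max_chains_iff_nth)
qed

lemma interval_max_chains_drop:
  assumes "c \<in> interval_max_chains Q x y" "i < length c"
  shows "drop i c \<in> interval_max_chains Q (c ! i) y"
  using assms by (auto simp: interval_max_chains_iff_nth)

lemma interval_max_chains_le:
  assumes "c \<in> interval_max_chains Q x y"
  shows "x \<le> y"
proof -
  have "successively (\<le>) c"
    using assms by (auto simp: interval_max_chains_def covers_def elim: successively_mono)
  then have "sorted_wrt (\<le>) c"
    by (simp add: successively_conv_sorted_wrt)
  then show ?thesis
    using assms by (cases c) (auto simp: interval_max_chains_def)
qed

lemma interval_max_chains_ends:
  assumes "c \<in> interval_max_chains Q x y"
  shows "x \<in> Q" "y \<in> Q"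
  using assms by (auto simp: interval_max_chains_def)

lemma zero_hat_eqI: "\<lbrakk>b \<in> Q; \<And>x. x \<in> Q \<Longrightarrow> b \<le> x\<rbrakk> \<Longrightarrow> zero_hat Q = b"
  unfolding zero_hat_def by (rule Least_equality)

lemma one_hat_eqI: "\<lbrakk>u \<in> Q; \<And>x. x \<in> Q \<Longrightarrow> x \<le> u\<rbrakk> \<Longrightarrow> one_hat Q = u"
  unfolding one_hat_def by (rule Greatest_equality)

lemma
  assumes "bounded_poset Q"
  shows zero_hat_in: "zero_hat Q \<in> Q" and zero_hat_le: "x \<in> Q \<Longrightarrow> zero_hat Q \<le> x"
    and one_hat_in: "one_hat Q \<in> Q" and one_hat_ge: "x \<in> Q \<Longrightarrow> x \<le> one_hat Q"
proof -
  obtain b u where "b \<in> Q" "\<And>x. x \<in> Q \<Longrightarrow> b \<le> x" "u \<in> Q" "\<And>x. x \<in> Q \<Longrightarrow> x \<le> u"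
    using assms by (auto simp: bounded_poset_def)
  moreover from this have "zero_hat Q = b" "one_hat Q = u"
    by (auto intro: zero_hat_eqI one_hat_eqI)
  ultimately show "zero_hat Q \<in> Q" "x \<in> Q \<Longrightarrow> zero_hat Q \<le> x"
    "one_hat Q \<in> Q" "x \<in> Q \<Longrightarrow> x \<le> one_hat Q"
    by auto
qed

section \<open>Finite bounded graded posets and their rank function\<close>

locale finite_graded_poset =
  fixes Q :: "'a::order set"
  assumes fin: "finite Q" and bounded: "bounded_poset Q" and graded: "graded_poset Q"
begin

text \<open>By finiteness, the elements from \<open>x\<close> up to but excluding \<open>y\<close>
  have a maximal one; it is covered by \<open>y\<close> and has fewer elements below it, so a chain
  to it exists by induction and extends by one step.\<close>

lemma interval_max_chains_nonempty:
  assumes "x \<in> Q" "y \<in> Q" "x \<le> y"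
  shows "interval_max_chains Q x y \<noteq> {}"
  using assms
proof (induction "card {z \<in> Q. z < y}" arbitrary: y rule: less_induct)
  case less
  show ?case
  proof (cases "x = y")
    case True
    then have "[x] \<in> interval_max_chains Q x y"
      using less.prems by (simp add: interval_max_chains_def)
    then show ?thesis by blast
  next
    case False
    let ?S = "{z \<in> Q. x \<le> z \<and> z < y}"
    have "finite ?S" "?S \<noteq> {}"
      using fin False less.prems by auto
    from finite_has_maximal[OF this]
    obtain z where z: "z \<in> ?S" "\<forall>w\<in>?S. z \<le> w \<longrightarrow> z = w" by blast
    then have cov: "covers Q z y"
      using less.prems by (fastforce simp: covers_def)
    have "{w \<in> Q. w < z} \<subset> {w \<in> Q. w < y}"
      using z by auto
    then have "card {w \<in> Q. w < z} < card {w \<in> Q. w < y}"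
      using fin by (simp add: psubset_card_mono)
    then obtain c where "c \<in> interval_max_chains Q x z"
      using less.hyps[of z] less.prems z by auto
    moreover have "[z, y] \<in> interval_max_chains Q z y"
      using cov by (simp add: interval_max_chains_def covers_def)
    ultimately show ?thesis
      using interval_max_chains_append by blast
  qed
qed

text \<open>Gradedness makes all these lists equally long, which justifies the definite description
  in \<open>rk\<close>. The successor arises because a list has one more entry than the chain has
  steps.\<close>

lemma length_chain_from_zero:
  assumes "c \<in> interval_max_chains Q (zero_hat Q) x"
  shows "length c = Suc (rk Q x)"
proof -
  obtain k where k: "length c = Suc k"
    using assms by (cases c) (auto simp: interval_max_chains_def)
  have "length d = length c" if "d \<in> interval_max_chains Q (zero_hat Q) x" for d
    using graded that assms interval_max_chains_ends[OF assms] unfolding graded_poset_def by blast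
  then have "rk Q x = k"
    unfolding rk_def using assms k by (intro the_equality) fastforce+
  then show ?thesis using k by simp
qed

text \<open>Put a chain from the bottom to \<open>x\<close> in front. The shared element
  \<open>x\<close> is counted once, which accounts for the \<open>Suc\<close>.\<close>

lemma rk_chain:
  assumes "c \<in> interval_max_chains Q x y"
  shows "Suc (rk Q y) = rk Q x + length c"
proof -
  obtain d where d: "d \<in> interval_max_chains Q (zero_hat Q) x"
    using interval_max_chains_nonempty zero_hat_in zero_hat_le bounded
      interval_max_chains_ends[OF assms] by blast
  have "length (d @ tl c) = Suc (rk Q y)"
    using length_chain_from_zero interval_max_chains_append d assms by blast
  moreover have "c \<noteq> []" using assms by (simp add: interval_max_chains_def)
  ultimately show ?thesis
    using length_chain_from_zero[OF d] by (cases c) auto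
qed

lemma rk_nth:
  assumes "c \<in> interval_max_chains Q x y" "i < length c"
  shows "rk Q (c ! i) = rk Q x + i"
  using rk_chain[OF interval_max_chains_take[OF assms]] assms by simp

lemma rk_zero_hat [simp]: "rk Q (zero_hat Q) = 0"
proof -
  have "[zero_hat Q] \<in> interval_max_chains Q (zero_hat Q) (zero_hat Q)"
    using zero_hat_in[OF bounded] by (simp add: interval_max_chains_def)
  from length_chain_from_zero[OF this] show ?thesis by simp
qed

lemma rk_covers:
  assumes "covers Q x y"
  shows "rk Q y = Suc (rk Q x)"
proof -
  have "[x, y] \<in> interval_max_chains Q x y"
    using assms by (simp add: interval_max_chains_def covers_def)
  from rk_chain[OF this] show ?thesis by simp
qed

lemma rk_strict_mono:
  assumes "x \<in> Q" "y \<in> Q" "x < y"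
  shows "rk Q x < rk Q y"
proof -
  obtain c where c: "c \<in> interval_max_chains Q x y"
    using interval_max_chains_nonempty[of x y] assms by (auto simp: less_imp_le)
  then have "length c \<noteq> 0" "length c \<noteq> 1"
    using assms by (auto simp: interval_max_chains_def length_Suc_conv)
  then show ?thesis using rk_chain[OF c] by linarith
qed

text \<open>Ranks are strictly monotone, so every element other than the bounds has a rank strictly
  between 0 and that of the top. Results on the whole poset thus become the case of all inner
  ranks.\<close>

lemma rank_selected_full: "rank_selected Q {1..poset_rank Q - 1} = Q"
proof -
  have "rk Q x \<in> {1..poset_rank Q - 1}" if "x \<in> Q" "x \<noteq> zero_hat Q" "x \<noteq> one_hat Q" for x
  proof -
    have "zero_hat Q < x" "x < one_hat Q"
      using that zero_hat_le[OF bounded, of x] one_hat_ge[OF bounded, of x] by (simp_all add: order_less_le)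
    then have "rk Q (zero_hat Q) < rk Q x" "rk Q x < rk Q (one_hat Q)"
      using that zero_hat_in[OF bounded] one_hat_in[OF bounded] rk_strict_mono by blast+
    then show ?thesis by (simp add: poset_rank_def)
  qed
  then show ?thesis
    using zero_hat_in[OF bounded] one_hat_in[OF bounded]
    by (auto simp: rank_selected_def)
qed

lemma mu_rank_selected:
  "mu (rank_selected Q J) = moebius (rank_selected Q J) (zero_hat Q) (one_hat Q)"
proof -
  have "zero_hat (rank_selected Q J) = zero_hat Q" "one_hat (rank_selected Q J) = one_hat Q"
    using bounded zero_hat_in[OF bounded]  one_hat_in[OF bounded]
    by (auto intro!: zero_hat_eqI one_hat_eqI zero_hat_le one_hat_ge simp: rank_selected_def)
  then show ?thesis by (simp add: mu_def)
qed

end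

section \<open>Descent sets of chains and Moebius values of rank selections\<close>

definition chain_Des :: "('a \<Rightarrow> 'a \<Rightarrow> 'a \<Rightarrow> bool) \<Rightarrow> 'a list \<Rightarrow> nat set" where
  "chain_Des A c = {i \<in> {1..<length c - 1}. \<not> A (c ! (i - 1)) (c ! i) (c ! Suc i)}"

text \<open>List indices start at 0, so in a chain from the bottom the position of an element is its
  rank. Position \<open>j\<close> is the end of the prefix, hence no longer interior, and drops
  out.\<close>

lemma chain_Des_take: "j < length c \<Longrightarrow> chain_Des A (take (Suc j) c) = chain_Des A c \<inter> {1..<j}"
  by (auto simp: chain_Des_def min_def)

text \<open>Positions shift by \<open>j\<close>; position \<open>j\<close> itself becomes the start
  of the suffix and no longer counts, whence \<open>1 \<le> i\<close>.\<close>

lemma chain_Des_drop: "i \<in> chain_Des A (drop j c) \<longleftrightarrow> 1 \<le> i \<and> i + j \<in> chain_Des A c"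
proof (cases "1 \<le> i \<and> i + j < length c - 1")
  case True
  then show ?thesis by (auto simp: chain_Des_def add.commute)
next
  case False
  then show ?thesis by (auto simp: chain_Des_def)
qed

text \<open>With the elements of \<open>J\<close> listed in increasing order,
  \<open>J \<inter> {..<j}\<close> runs through the proper prefixes of \<open>J\<close> and
  \<open>insert j\<close> leads to the next prefix. Signs alternate, so each inner prefix occurs
  twice with opposite signs.\<close>

lemma telescoping_sum_prefix:
  fixes \<beta> :: "nat set \<Rightarrow> int"
  assumes "finite J"
  shows "(\<Sum>j\<in>J. (-1) ^ card (J \<inter> {..<j}) * (\<beta> (J \<inter> {..<j}) + \<beta> (insert j (J \<inter> {..<j}))))
    = \<beta> {} - (-1) ^ card J * \<beta> J"
  using assms
proof (induction rule: finite_linorder_max_induct)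
  case empty
  then show ?case by simp
next
  case (insert m J)
  \<comment> \<open>The new element \<open>m\<close> is the largest, so the terms of the earlier
    elements do not change and a single term is added.\<close>
  have "insert m J \<inter> {..<m} = J" "m \<notin> J" using insert by auto
  moreover have "insert m J \<inter> {..<j} = J \<inter> {..<j}" if "j \<in> J" for j
    using insert that by force
  ultimately show ?case using insert by (simp add: algebra_simps)
qed

text \<open>\<open>A x y z\<close> says that a chain through the consecutive elements
  \<open>x\<close>, \<open>y\<close>, \<open>z\<close> ascends at \<open>y\<close>. The assumption
  is the existence of a unique increasing chain in each interval, expressed through
  \<open>A\<close>.\<close>

locale ascent_graded_poset = finite_graded_poset Q for Q :: "'a::order set" +
  fixes A :: "'a \<Rightarrow> 'a \<Rightarrow> 'a \<Rightarrow> bool"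
  assumes ex1_ascending: "\<lbrakk>x \<in> Q; y \<in> Q; x \<le> y\<rbrakk> \<Longrightarrow>
    \<exists>!c. c \<in> interval_max_chains Q x y \<and> chain_Des A c = {}"
begin

text \<open>At the top element this is the beta invariant of rank selection, in its form as a number
  of chains. Other \<open>y\<close> occur because the Moebius recursion passes through lower
  intervals.\<close>

definition beta :: "nat set \<Rightarrow> 'a \<Rightarrow> nat" where
  "beta K y = card {c \<in> interval_max_chains Q (zero_hat Q) y. chain_Des A c = K}"

lemma beta_empty: "y \<in> Q \<Longrightarrow> beta {} y = 1"
  using ex1_ascending[OF zero_hat_in[OF bounded] _ zero_hat_le[OF bounded], of y]
  unfolding beta_def by (auto simp: card_1_singleton_iff)

text \<open>A chain up to \<open>z\<close> extends to \<open>y\<close> without a descent above \<open>z\<close> in exactly one way.\<close>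

lemma sum_beta:
  assumes "y \<in> Q" "1 \<le> j" "j < rk Q y" "K \<subseteq> {1..<j}"
  shows "(\<Sum>z\<in>{z \<in> Q. z < y \<and> rk Q z = j}. beta K z) = beta K y + beta (insert j K) y"
proof -
  let ?M = "interval_max_chains Q" and ?T = "{z \<in> Q. z < y \<and> rk Q z = j}"
  \<comment> \<open>Below \<open>j\<close> the descents are prescribed by \<open>K\<close>, above
    \<open>j\<close> there are none, and at \<open>j\<close> both are allowed. Both sides of the
    claim count this set.\<close>
  let ?R = "{c \<in> ?M (zero_hat Q) y. chain_Des A c \<inter> {1..<j} = K \<and> chain_Des A c \<subseteq> {1..j}}"
  have "finite ?R" "finite ?T" using fin by (simp_all add: finite_interval_max_chains)
  have len: "length c = Suc (rk Q z)" if "c \<in> ?M (zero_hat Q) z" for c z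
    using that by (rule length_chain_from_zero)
  have "beta K z = card {c \<in> ?R. c ! j = z}" if z: "z \<in> ?T" for z
  proof -
    have "\<exists>!c. c \<in> ?M z y \<and> chain_Des A c = {}"
      using ex1_ascending[of z y] z assms(1) by (simp add: less_imp_le)
    then obtain e where e: "e \<in> ?M z y" "chain_Des A e = {}"
      and e_unique: "\<And>c. c \<in> ?M z y \<Longrightarrow> chain_Des A c = {} \<Longrightarrow> c = e"
      by blast
    \<comment> \<open>The inverse refills the upper part with the only ascending chain
      \<open>e\<close> from \<open>z\<close> to \<open>y\<close>; \<open>tl\<close> removes the
      second copy of \<open>z\<close>.\<close>
    have "bij_betw (take (Suc j)) {c \<in> ?R. c ! j = z} {c \<in> ?M (zero_hat Q) z. chain_Des A c = K}"
    proof (rule bij_betw_byWitness[where f' = "\<lambda>d. d @ tl e"])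
      show "\<forall>c\<in>{c \<in> ?R. c ! j = z}. take (Suc j) c @ tl e = c"
      proof
        fix c assume c: "c \<in> {c \<in> ?R. c ! j = z}"
        then have j: "j < length c" using len assms by auto
        have "chain_Des A (drop j c) = {}"
          using c by (auto simp: chain_Des_drop set_eq_iff)
        moreover have "drop j c \<in> ?M z y"
          using c interval_max_chains_drop[OF _ j] by auto
        ultimately have "drop j c = e" by (rule e_unique[rotated])
        then have "tl e = drop (Suc j) c" by (metis drop_Suc tl_drop)
        then show "take (Suc j) c @ tl e = c" by simp
      qed
      show "\<forall>d\<in>{c \<in> ?M (zero_hat Q) z. chain_Des A c = K}. take (Suc j) (d @ tl e) = d"
        using len z by auto
      show "take (Suc j) ` {c \<in> ?R. c ! j = z} \<subseteq> {c \<in> ?M (zero_hat Q) z. chain_Des A c = K}"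
        using len assms interval_max_chains_take[of _ Q "zero_hat Q" y j]
        by (auto simp: chain_Des_take)
      show "(\<lambda>d. d @ tl e) ` {c \<in> ?M (zero_hat Q) z. chain_Des A c = K} \<subseteq> {c \<in> ?R. c ! j = z}"
      proof (rule image_subsetI)
        fix d assume "d \<in> {c \<in> ?M (zero_hat Q) z. chain_Des A c = K}"
        then have d: "d \<in> ?M (zero_hat Q) z" "chain_Des A d = K" by auto
        let ?c = "d @ tl e"
        have ld: "length d = Suc j" and dne: "d \<noteq> []" "last d = z" "e \<noteq> []" "hd e = z"
          using len d z e by (auto simp: interval_max_chains_def)
        have nth: "?c ! j = z" using ld dne by (simp add: nth_append last_conv_nth)
        have "drop j d = [z]"
          using ld nth by (simp add: Cons_nth_drop_Suc[symmetric] nth_append)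
        then have "drop j ?c = e"
          using ld dne by (cases e) simp_all
        then have "chain_Des A (drop j ?c) = {}" using e by simp
        then have "\<not> (1 \<le> i \<and> i + j \<in> chain_Des A ?c)" for i
          using chain_Des_drop[of i A j ?c] by blast
        then have "i \<le> j" if "i \<in> chain_Des A ?c" for i
          using that by (metis le_add_diff_inverse2 less_imp_le_nat not_le zero_less_diff less_eq_Suc_le One_nat_def)
        then have "chain_Des A ?c \<subseteq> {1..j}" by (auto simp: chain_Des_def)
        moreover have "chain_Des A ?c \<inter> {1..<j} = chain_Des A d"
          using chain_Des_take[of j ?c A] ld by simp
        ultimately show "?c \<in> {c \<in> ?R. c ! j = z}"
          using interval_max_chains_append[OF d(1) e(1)] nth d(2) by blast
      qed
    qed
    then show ?thesis by (simp add: beta_def bij_betw_same_card)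
  qed
  \<comment> \<open>Position \<open>j\<close> has rank \<open>j\<close>, which is less than the rank
    of \<open>y\<close>; so the element there is strictly below \<open>y\<close>, and
    \<open>?R\<close> splits into the fibres counted above.\<close>
  moreover have "(\<lambda>c. c ! j) ` ?R \<subseteq> ?T"
  proof (rule image_subsetI)
    fix c assume "c \<in> ?R"
    then have c: "c \<in> ?M (zero_hat Q) y" by simp
    then have j: "j < length c" using len assms by simp
    have rk: "rk Q (c ! j) = j" using rk_nth[OF c j] by simp
    moreover have "c ! j \<le> y"
      using interval_max_chains_le[OF interval_max_chains_drop[OF c j]] .
    ultimately show "c ! j \<in> ?T"
      using interval_max_chains_nth[OF c j] assms by (auto simp: order_less_le)
  qed
  then have "(\<Sum>z\<in>?T. \<Sum>c\<in>{c \<in> ?R. c ! j = z}. 1) = (\<Sum>c\<in>?R. 1::nat)"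
    using \<open>finite ?R\<close> \<open>finite ?T\<close> by (intro sum.group)
  ultimately have "(\<Sum>z\<in>?T. beta K z) = card ?R" by simp
  \<comment> \<open>The only freedom left is whether \<open>j\<close> is a descent.\<close>
  also have "?R = {c \<in> ?M (zero_hat Q) y. chain_Des A c = K}
      \<union> {c \<in> ?M (zero_hat Q) y. chain_Des A c = insert j K}" (is "_ = ?B \<union> ?C")
  proof -
    have eq: "D \<inter> {1..<j} = K \<and> D \<subseteq> {1..j} \<longleftrightarrow> D = K \<or> D = insert j K" for D
    proof -
      have "{1..j} = insert j {1..<j}" using assms by auto
      then show ?thesis using assms(2,4) by auto
    qed
    show ?thesis unfolding eq by blast
  qed
  also have "card (?B \<union> ?C) = card ?B + card ?C"
    using assms(4) fin by (intro card_Un_disjoint) (auto simp: finite_interval_max_chains)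
  finally show ?thesis by (simp add: beta_def)
qed

text \<open>The recursion at \<open>y\<close> sums over the bottom and the selected elements of each
  rank \<open>j\<close> below that of \<open>y\<close>. Induction on the rank turns these values
  into chain counts, \<open>sum_beta\<close> moves the counts from rank \<open>j\<close> up to
  \<open>y\<close>, and the result telescopes. The rank of \<open>y\<close> need not be in
  \<open>J\<close>, so the top is covered too.\<close>

lemma moebius_rank_selected:
  assumes "0 \<notin> J" "y \<in> Q" "y \<noteq> zero_hat Q"
  shows "moebius (rank_selected Q J) (zero_hat Q) y =
    - ((-1) ^ card (J \<inter> {..<rk Q y}) * int (beta (J \<inter> {..<rk Q y}) y))"
  using assms(2,3)
proof (induction "rk Q y" arbitrary: y rule: less_induct)
  case less
  let ?b = "zero_hat Q" and ?X = "rank_selected Q J" and ?J = "J \<inter> {..<rk Q y}"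
  have b: "?b \<in> Q" "\<And>x. x \<in> Q \<Longrightarrow> ?b \<le> x"
    using zero_hat_in[OF bounded] zero_hat_le[OF bounded] by auto
  have lt: "?b < y" using b less.prems by (simp add: order_less_le)
  let ?Z = "{z \<in> ?X. ?b \<le> z \<and> z < y}"
    and ?T = "\<lambda>j. {z \<in> Q. z < y \<and> rk Q z = j}"
  have "finite ?X" "?X \<subseteq> Q"
    using fin b one_hat_in[OF bounded] by (auto simp: rank_selected_def)
  have not_top: "\<not> one_hat Q < y"
    using one_hat_ge[OF bounded \<open>y \<in> Q\<close>] by auto
  have Z: "?Z = insert ?b (\<Union>j\<in>?J. ?T j)"
    using b not_top lt rk_strict_mono[OF _ \<open>y \<in> Q\<close>]
    by (auto simp: rank_selected_def)
  \<comment> \<open>The bottom has rank 0, which is not in \<open>J\<close>; its Moebius value 1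
    forms a separate summand.\<close>
  have b_notin: "?b \<notin> (\<Union>j\<in>?J. ?T j)" using assms(1) by auto
  have "finite ?Z" using \<open>finite ?X\<close> by simp
  have "(\<Sum>z\<in>?Z. moebius ?X ?b z) = 1 + (\<Sum>z\<in>(\<Union>j\<in>?J. ?T j). moebius ?X ?b z)"
    unfolding Z using b_notin fin by (simp add: moebius.simps[of _ ?b ?b])
  also have "(\<Sum>z\<in>(\<Union>j\<in>?J. ?T j). moebius ?X ?b z) = (\<Sum>j\<in>?J. \<Sum>z\<in>?T j. moebius ?X ?b z)"
    using fin by (intro sum.UNION_disjoint) auto
  also have "\<dots> = (\<Sum>j\<in>?J. - ((-1) ^ card (?J \<inter> {..<j}) *
      (int (beta (?J \<inter> {..<j}) y) + int (beta (insert j (?J \<inter> {..<j})) y))))"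
  proof (rule sum.cong)
    fix j assume j: "j \<in> ?J"
    then have j1: "1 \<le> j" "j < rk Q y" using assms(1) by (auto simp: Suc_le_eq intro: gr0I)
    have Jj: "J \<inter> {..<j} = ?J \<inter> {..<j}" using j by auto
    \<comment> \<open>For all \<open>z\<close> of rank \<open>j\<close> the induction hypothesis
      involves the same prefix of \<open>J\<close>, so the sign factors out of the sum over
      \<open>z\<close>.\<close>
    have "moebius ?X ?b z = - ((-1) ^ card (?J \<inter> {..<j}) * int (beta (?J \<inter> {..<j}) z))"
      if z: "z \<in> ?T j" for z
    proof -
      have "z \<noteq> ?b" using z j1 by auto
      then show ?thesis using less.hyps[of z] z j1 Jj by auto
    qed
    then have "(\<Sum>z\<in>?T j. moebius ?X ?b z) =
        (\<Sum>z\<in>?T j. - ((-1) ^ card (?J \<inter> {..<j}) * int (beta (?J \<inter> {..<j}) z)))"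
      by (intro sum.cong) auto
    also have "\<dots> = - ((-1) ^ card (?J \<inter> {..<j}) * int (\<Sum>z\<in>?T j. beta (?J \<inter> {..<j}) z))"
      by (simp add: sum_negf sum_distrib_left)
    also have "(\<Sum>z\<in>?T j. beta (?J \<inter> {..<j}) z) =
        beta (?J \<inter> {..<j}) y + beta (insert j (?J \<inter> {..<j})) y"
    proof (rule sum_beta)
      show "?J \<inter> {..<j} \<subseteq> {1..<j}"
        using assms(1) by (auto simp: Suc_le_eq intro: gr0I)
    qed (use j1 less.prems in auto)
    finally show "(\<Sum>z\<in>?T j. moebius ?X ?b z) = - ((-1) ^ card (?J \<inter> {..<j}) *
      (int (beta (?J \<inter> {..<j}) y) + int (beta (insert j (?J \<inter> {..<j})) y)))" by simp
  qed simp
  \<comment> \<open>The 1 is \<open>beta {} y\<close>, the single ascending chain up to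
    \<open>y\<close>; it cancels the summand of the bottom.\<close>
  also have "\<dots> = - (1 - (-1) ^ card ?J * int (beta ?J y))"
    using telescoping_sum_prefix[of ?J "\<lambda>K. int (beta K y)"] beta_empty[OF \<open>y \<in> Q\<close>]
    by (simp add: sum_negf)
  finally show ?case
    using lt \<open>finite ?Z\<close> by (simp add: moebius.simps[of ?X ?b y])
qed

text \<open>This is the case where \<open>y\<close> is the top: all of \<open>J\<close> lies below
  its rank, and positive rank separates it from the bottom.\<close>

theorem mu_rank_selected_eq_card:
  assumes "J \<subseteq> {1..poset_rank Q - 1}" "poset_rank Q \<ge> 1"
  shows "mu (rank_selected Q J) = - ((-1) ^ card J * int (card {c \<in> max_chains Q. chain_Des A c = J}))"
proof -
  have "{1..poset_rank Q - 1} \<subseteq> {..<rk Q (one_hat Q)}"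
    using assms(2) by (auto simp: poset_rank_def)
  then have "J \<inter> {..<rk Q (one_hat Q)} = J" "0 \<notin> J"
    using assms(1) by auto
  moreover have "one_hat Q \<noteq> zero_hat Q"
    using assms by (auto simp: poset_rank_def)
  ultimately show ?thesis
    using moebius_rank_selected[of J "one_hat Q"] one_hat_in[OF bounded]
    by (simp add: mu_rank_selected beta_def max_chains_def)
qed

corollary real_mu_rank_selected:
  assumes "J \<subseteq> {1..poset_rank Q - 1}" "poset_rank Q \<ge> 1"
  shows "(-1) powi (int (card J) - 1) * real_of_int (mu (rank_selected Q J)) =
    real (card {c \<in> max_chains Q. chain_Des A c = J})"
proof -
  \<comment> \<open>The exponent is -1 for empty \<open>J\<close>, hence an integer power over the
    reals.\<close>
  have "(-1::real) powi (int (card J) - 1) = - ((-1) ^ card J)"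
    by (simp add: power_int_diff)
  then show ?thesis
    by (simp add: mu_rank_selected_eq_card[OF assms] flip: power_mult_distrib)
qed

corollary real_mu:
  assumes "poset_rank Q \<ge> 1"
  shows "(-1) powi (int (poset_rank Q) - 2) * real_of_int (mu Q) =
    real (card {c \<in> max_chains Q. chain_Des A c = {1..poset_rank Q - 1}})"
proof -
  have "int (card {1..poset_rank Q - 1}) - 1 = int (poset_rank Q) - 2"
    using assms by simp
  then show ?thesis
    using real_mu_rank_selected[of "{1..poset_rank Q - 1}"] assms
    by (simp only: rank_selected_full)
qed

end

section \<open>Segre powers and their maximal chains\<close>

definition segre_ascent ::
  "nat \<Rightarrow> ('a \<Rightarrow> 'a \<Rightarrow> 'a \<Rightarrow> bool) \<Rightarrow> (nat \<Rightarrow> 'a) \<Rightarrow> (nat \<Rightarrow> 'a) \<Rightarrow> (nat \<Rightarrow> 'a) \<Rightarrow> bool" where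
  "segre_ascent t A x y z \<longleftrightarrow> (\<forall>i\<in>{1..t}. A (x i) (y i) (z i))"

definition component_chains :: "nat \<Rightarrow> (nat \<Rightarrow> 'a) list \<Rightarrow> nat \<Rightarrow> 'a list" where
  "component_chains t c = (\<lambda>i\<in>{1..t}. map (\<lambda>f. f i) c)"

lemma component_chains_apply: "i \<in> {1..t} \<Longrightarrow> component_chains t c i = map (\<lambda>f. f i) c"
  by (simp add: component_chains_def)

text \<open>An ascent is strict in every component, matching the intersection in
  \<open>Des_tuple\<close>; its negation is a descent in some component.\<close>

lemma chain_Des_segre_ascent:
  "chain_Des (segre_ascent t A) c = (\<Union>i\<in>{1..t}. chain_Des A (component_chains t c i))"
  by (auto simp: chain_Des_def segre_ascent_def component_chains_apply)

lemma segre_power_PiE: "x \<in> segre_power Q t \<Longrightarrow> x \<in> {1..t} \<rightarrow>\<^sub>E Q"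
  unfolding segre_power_def by blast

lemma segre_power_rk:
  "\<lbrakk>x \<in> segre_power Q t; i \<in> {1..t}; j \<in> {1..t}\<rbrakk> \<Longrightarrow> rk Q (x i) = rk Q (x j)"
  unfolding segre_power_def by blast

lemma restrict_in_segre_power:
  assumes "\<And>i. i \<in> {1..t} \<Longrightarrow> f i \<in> Q" "\<And>i. i \<in> {1..t} \<Longrightarrow> rk Q (f i) = r"
  shows "(\<lambda>i\<in>{1..t}. f i) \<in> segre_power Q t"
  using assms unfolding segre_power_def by simp

lemma segre_power_apply: "x \<in> segre_power Q t \<Longrightarrow> i \<in> {1..t} \<Longrightarrow> x i \<in> Q"
  unfolding segre_power_def by blast

lemma segre_power_ext:
  assumes "x \<in> segre_power Q t" "y \<in> segre_power Q t" "\<And>i. i \<in> {1..t} \<Longrightarrow> x i = y i"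
  shows "x = y"
  using segre_power_PiE[OF assms(1)] segre_power_PiE[OF assms(2)] assms(3) by (rule PiE_ext)

lemma segre_power_le_iff:
  assumes "x \<in> segre_power Q t" "y \<in> segre_power Q t"
  shows "x \<le> y \<longleftrightarrow> (\<forall>i\<in>{1..t}. x i \<le> y i)"
proof
  assume "\<forall>i\<in>{1..t}. x i \<le> y i"
  moreover have "x i = y i" if "i \<notin> {1..t}" for i
    using PiE_arb[OF segre_power_PiE[OF assms(1)] that] PiE_arb[OF segre_power_PiE[OF assms(2)] that]
    by (simp only:)
  ultimately have "x i \<le> y i" for i
    by (metis order_refl)
  then show "x \<le> y" by (simp add: le_fun_def)
qed (simp add: le_fun_def)

context finite_graded_poset
begin

text \<open>The second element of a maximal chain from \<open>x\<close> to \<open>y\<close> serves;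
  the chain has one because the ranks differ.\<close>

lemma exists_cover_below:
  assumes "x \<in> Q" "y \<in> Q" "x < y"
  obtains z where "covers Q x z" "z \<le> y"
proof -
  obtain c where c: "c \<in> interval_max_chains Q x y"
    using interval_max_chains_nonempty[of x y] assms by (auto simp: less_imp_le)
  then have 1: "1 < length c"
    using rk_chain[OF c] rk_strict_mono[OF assms] by linarith
  then have "covers Q x (c ! 1)"
    using c unfolding interval_max_chains_iff_nth by (metis One_nat_def)
  with interval_max_chains_le[OF interval_max_chains_drop[OF c 1]] show thesis
    using that by blast
qed

text \<open>Some coordinate increases strictly, and so does its rank. All coordinates of a tuple
  share one rank, so the increase occurs in every coordinate.\<close>

lemma segre_power_rk_less:
  assumes "x \<in> segre_power Q t" "y \<in> segre_power Q t" "x < y" "k \<in> {1..t}"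
  shows "rk Q (x k) < rk Q (y k)"
proof -
  obtain i where i: "i \<in> {1..t}" "x i \<noteq> y i"
    using segre_power_ext[OF assms(1,2)] assms(3) by auto
  moreover have "x i \<le> y i" using assms(3) by (simp add: less_imp_le le_funD)
  ultimately have "rk Q (x i) < rk Q (y i)"
    using segre_power_apply assms i by (intro rk_strict_mono) (auto simp: order_less_le)
  moreover have "rk Q (x k) = rk Q (x i)" "rk Q (y k) = rk Q (y i)"
    using segre_power_rk assms i by blast+
  ultimately show ?thesis by simp
qed

context
  fixes t :: nat
  assumes t: "1 \<le> t"
begin

text \<open>From left to right, choose in each coordinate a cover of \<open>x j\<close> below
  \<open>y j\<close>. These covers have equal ranks, so they form an element of the Segre power
  above \<open>x\<close> and at most \<open>y\<close>, which must be \<open>y\<close>. Conversely,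
  an element strictly between would have a rank strictly between two consecutive numbers.\<close>

lemma covers_segre_power_iff:
  "covers (segre_power Q t) x y \<longleftrightarrow>
     x \<in> segre_power Q t \<and> y \<in> segre_power Q t \<and> (\<forall>i\<in>{1..t}. covers Q (x i) (y i))"
proof (intro iffI conjI ballI; (elim conjE)?)
  assume cov: "covers (segre_power Q t) x y"
  then show x: "x \<in> segre_power Q t" and y: "y \<in> segre_power Q t" by (auto simp: covers_def)
  fix i assume i: "i \<in> {1..t}"
  have "x < y" using cov by (simp add: covers_def)
  have "\<exists>z. covers Q (x j) z \<and> z \<le> y j" if j: "j \<in> {1..t}" for j
  proof -
    have "rk Q (x j) < rk Q (y j)" by (rule segre_power_rk_less[OF x y \<open>x < y\<close> j])
    moreover have "x j \<le> y j" using \<open>x < y\<close> by (simp add: less_imp_le le_funD)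
    ultimately have "x j < y j" by (auto simp: order_less_le)
    then show ?thesis
      using exists_cover_below segre_power_apply[OF x j] segre_power_apply[OF y j] by metis
  qed
  then obtain w where w: "\<And>j. j \<in> {1..t} \<Longrightarrow> covers Q (x j) (w j) \<and> w j \<le> y j" by metis
  let ?z = "\<lambda>j\<in>{1..t}. w j"
  have "rk Q (w j) = Suc (rk Q (x i))" if "j \<in> {1..t}" for j
    using rk_covers[of "x j" "w j"] w that segre_power_rk[OF x that i] by simp
  then have z: "?z \<in> segre_power Q t"
    using w by (intro restrict_in_segre_power) (auto simp: covers_def)
  have "x \<le> ?z" "?z \<le> y"
    using w segre_power_le_iff[OF x z] segre_power_le_iff[OF z y]
    by (auto simp: covers_def less_imp_le)
  moreover have "x \<noteq> ?z"
    using w[OF i] i by (auto simp: covers_def)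
  ultimately have "?z = y"
    using cov z by (auto simp: covers_def order_less_le)
  then show "covers Q (x i) (y i)" using w[OF i] i by auto
next
  assume x: "x \<in> segre_power Q t" and y: "y \<in> segre_power Q t"
    and cov: "\<forall>i\<in>{1..t}. covers Q (x i) (y i)"
  have 1: "1 \<in> {1..t}" using t by simp
  have "x \<le> y" using segre_power_le_iff[OF x y] cov by (auto simp: covers_def less_imp_le)
  moreover have "x \<noteq> y" using cov 1 by (auto simp: covers_def)
  moreover have False if z: "z \<in> segre_power Q t" "x < z" "z < y" for z
    using segre_power_rk_less[OF x z(1,2) 1] segre_power_rk_less[OF z(1) y z(3) 1]
      rk_covers[of "x 1" "y 1"] cov 1 by auto
  ultimately show "covers (segre_power Q t) x y"
    using x y by (auto simp: covers_def order_less_le)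
qed

lemma component_chain_in:
  assumes "c \<in> interval_max_chains (segre_power Q t) x y" "i \<in> {1..t}"
  shows "map (\<lambda>f. f i) c \<in> interval_max_chains Q (x i) (y i)"
proof -
  have "f i \<in> Q" if "f \<in> segre_power Q t" for f
    using segre_power_apply[OF that assms(2)] .
  then show ?thesis
    using assms unfolding interval_max_chains_iff_nth covers_segre_power_iff by auto
qed

text \<open>Transposing a list of tuples loses nothing. Conversely, component chains run between
  elements of equal ranks, so they have equal lengths and agree in rank at each position; reading
  them position by position gives a chain of the Segre power.\<close>

lemma bij_betw_component_chains:
  assumes x: "x \<in> segre_power Q t" and y: "y \<in> segre_power Q t"
  shows "bij_betw (component_chains t) (interval_max_chains (segre_power Q t) x y)
    (\<Pi>\<^sub>E i\<in>{1..t}. interval_max_chains Q (x i) (y i))"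
    (is "bij_betw _ ?C ?D")
proof (rule bij_betw_imageI)
  have 1: "1 \<in> {1..t}" using t by simp
  show "inj_on (component_chains t) ?C"
  proof (rule inj_onI)
    fix c d assume c: "c \<in> ?C" and d: "d \<in> ?C" and eq: "component_chains t c = component_chains t d"
    have eq: "map (\<lambda>f. f i) c = map (\<lambda>f. f i) d" if "i \<in> {1..t}" for i
      using fun_cong[OF eq, of i] that by (simp add: component_chains_apply)
    then have len: "length c = length d" using 1 by (metis length_map)
    show "c = d"
    proof (rule nth_equalityI[OF len])
      fix k assume k: "k < length c"
      have "(c ! k) i = (d ! k) i" if "i \<in> {1..t}" for i
        using arg_cong[OF eq[OF that], of "\<lambda>l. l ! k"] k len by simp
      then show "c ! k = d ! k"
        using interval_max_chains_nth[OF c k] interval_max_chains_nth[OF d] k len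
        by (intro segre_power_ext) auto
    qed
  qed
  show "component_chains t ` ?C = ?D"
  proof (intro equalityI subsetI)
    fix cs assume "cs \<in> component_chains t ` ?C"
    then show "cs \<in> ?D" by (auto simp: component_chains_def component_chain_in)
  next
    fix cs assume cs: "cs \<in> ?D"
    then have csi: "cs i \<in> interval_max_chains Q (x i) (y i)" if "i \<in> {1..t}" for i
      using that by auto
    define m where "m = length (cs 1)"
    have len: "length (cs i) = m" if i: "i \<in> {1..t}" for i
    proof -
      have "rk Q (x i) = rk Q (x 1)" "rk Q (y i) = rk Q (y 1)"
        using segre_power_rk x y i 1 by blast+
      then show ?thesis
        using rk_chain[OF csi[OF i]] rk_chain[OF csi[OF 1]] by (simp add: m_def)
    qed
    have "m \<noteq> 0" using csi[OF 1] by (auto simp: interval_max_chains_def m_def)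
    \<comment> \<open>The tuple of the \<open>k\<close>-th elements, with the value
      \<open>undefined\<close> outside \<open>{1..t}\<close> that the Segre power requires.\<close>
    define g where "g k = (\<lambda>i\<in>{1..t}. cs i ! k)" for k
    let ?c = "map g [0..<m]"
    have g: "g k \<in> segre_power Q t" if k: "k < m" for k
    proof -
      have "rk Q (cs i ! k) = rk Q (x 1) + k" if i: "i \<in> {1..t}" for i
      proof -
        have "rk Q (x i) = rk Q (x 1)" by (rule segre_power_rk[OF x i 1])
        then show ?thesis using rk_nth[OF csi[OF i], of k] len[OF i] k by simp
      qed
      moreover have "cs i ! k \<in> Q" if i: "i \<in> {1..t}" for i
        using interval_max_chains_nth[OF csi[OF i], of k] len[OF i] k by simp
      ultimately show ?thesis unfolding g_def by (intro restrict_in_segre_power)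
    qed
    have cov: "covers (segre_power Q t) (g k) (g (Suc k))" if k: "Suc k < m" for k
      unfolding covers_segre_power_iff
      using g[of k] g[of "Suc k"] k csi len by (auto simp: g_def interval_max_chains_iff_nth)
    have "g 0 = x"
      using g[of 0] x \<open>m \<noteq> 0\<close> csi by (intro segre_power_ext) (auto simp: g_def interval_max_chains_iff_nth)
    moreover have "g (m - 1) = y"
      using g[of "m - 1"] y \<open>m \<noteq> 0\<close> csi len
      by (intro segre_power_ext) (auto simp: g_def interval_max_chains_iff_nth)
    ultimately have c: "?c \<in> ?C"
      using \<open>m \<noteq> 0\<close> g cov by (auto simp: interval_max_chains_iff_nth)
    have "component_chains t ?c = cs"
    proof (rule PiE_ext[OF _ cs])
      show "component_chains t ?c \<in> ?D"
        using c by (auto simp: component_chains_def component_chain_in simp del: map_map)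
      show "component_chains t ?c i = cs i" if "i \<in> {1..t}" for i
        using len[OF that] that by (auto simp: component_chains_apply g_def intro!: nth_equalityI)
    qed
    then show "cs \<in> component_chains t ` ?C" using c by blast
  qed
qed

lemma const_in_segre_power: "q \<in> Q \<Longrightarrow> (\<lambda>i\<in>{1..t}. q) \<in> segre_power Q t"
  by (intro restrict_in_segre_power) simp_all

lemma zero_hat_segre_power: "zero_hat (segre_power Q t) = (\<lambda>i\<in>{1..t}. zero_hat Q)"
  and one_hat_segre_power: "one_hat (segre_power Q t) = (\<lambda>i\<in>{1..t}. one_hat Q)"
  and bounded_segre_power: "bounded_poset (segre_power Q t)"
proof -
  let ?b = "\<lambda>i\<in>{1..t}. zero_hat Q" and ?u = "\<lambda>i\<in>{1..t}. one_hat Q"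
  have b: "?b \<in> segre_power Q t" and u: "?u \<in> segre_power Q t"
    using const_in_segre_power zero_hat_in[OF bounded] one_hat_in[OF bounded] by auto
  have "?b \<le> x \<and> x \<le> ?u" if x: "x \<in> segre_power Q t" for x
  proof -
    have "x i \<in> Q" if "i \<in> {1..t}" for i by (rule segre_power_apply[OF x that])
    then show ?thesis
      using segre_power_le_iff[OF b x] segre_power_le_iff[OF x u]
        zero_hat_le[OF bounded] one_hat_ge[OF bounded] by auto
  qed
  with b u show "zero_hat (segre_power Q t) = ?b" "one_hat (segre_power Q t) = ?u"
    "bounded_poset (segre_power Q t)"
    unfolding bounded_poset_def by (blast intro: zero_hat_eqI one_hat_eqI)+
qed

lemma finite_graded_poset_segre_power: "finite_graded_poset (segre_power Q t)"
proof
  have "segre_power Q t \<subseteq> {1..t} \<rightarrow>\<^sub>E Q" using segre_power_PiE by blast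
  then show "finite (segre_power Q t)"
    using finite_PiE[of "{1..t}" "\<lambda>_. Q"] fin finite_subset by blast
  show "bounded_poset (segre_power Q t)" by (rule bounded_segre_power)
  have "length c = length d" if "c \<in> interval_max_chains (segre_power Q t) x y"
    "d \<in> interval_max_chains (segre_power Q t) x y" for c d x y
  proof -
    have 1: "1 \<in> {1..t}" using t by simp
    show ?thesis
      using rk_chain[OF component_chain_in[OF that(1) 1]] rk_chain[OF component_chain_in[OF that(2) 1]]
      by simp
  qed
  then show "graded_poset (segre_power Q t)" unfolding graded_poset_def by blast
qed

text \<open>Projecting a maximal chain to its first component preserves its length and yields a
  maximal chain of \<open>Q\<close>.\<close>

lemma poset_rank_segre_power: "poset_rank (segre_power Q t) = poset_rank Q"
proof -
  interpret S: finite_graded_poset "segre_power Q t" by (rule finite_graded_poset_segre_power)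
  have 1: "1 \<in> {1..t}" using t by simp
  obtain c where c: "c \<in> interval_max_chains (segre_power Q t)
      (zero_hat (segre_power Q t)) (one_hat (segre_power Q t))"
    using S.interval_max_chains_nonempty zero_hat_in one_hat_in zero_hat_le S.bounded by blast
  from component_chain_in[OF c 1] have "map (\<lambda>f. f 1) c \<in> interval_max_chains Q (zero_hat Q) (one_hat Q)"
    using 1 by (simp add: zero_hat_segre_power one_hat_segre_power)
  from length_chain_from_zero[OF this] S.length_chain_from_zero[OF c] show ?thesis
    by (simp add: poset_rank_def)
qed

lemma card_segre_power_max_chains:
  "card {c \<in> max_chains (segre_power Q t). chain_Des (segre_ascent t A) c = J} =
   card {cs \<in> {1..t} \<rightarrow>\<^sub>E max_chains Q. (\<Union>i\<in>{1..t}. chain_Des A (cs i)) = J}"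
proof -
  have "(\<Pi>\<^sub>E i\<in>{1..t}. interval_max_chains Q (zero_hat (segre_power Q t) i) (one_hat (segre_power Q t) i))
      = {1..t} \<rightarrow>\<^sub>E max_chains Q"
    by (rule PiE_cong) (simp add: zero_hat_segre_power one_hat_segre_power max_chains_def)
  then have bij: "bij_betw (component_chains t) (max_chains (segre_power Q t)) ({1..t} \<rightarrow>\<^sub>E max_chains Q)"
    using bij_betw_component_chains[OF zero_hat_in one_hat_in, OF bounded_segre_power bounded_segre_power]
    by (simp only: max_chains_def)
  have "bij_betw (component_chains t)
      {c \<in> max_chains (segre_power Q t). chain_Des (segre_ascent t A) c = J}
      {cs \<in> {1..t} \<rightarrow>\<^sub>E max_chains Q. (\<Union>i\<in>{1..t}. chain_Des A (cs i)) = J}"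
    using bij unfolding bij_betw_def chain_Des_segre_ascent
    by (auto intro: inj_on_subset)
  then show ?thesis by (rule bij_betw_same_card)
qed

end

end

text \<open>Under the bijection with tuples of chains, a chain without descents is a tuple of chains
  without descents, and each component interval has exactly one of these.\<close>

lemma (in ascent_graded_poset) ascent_graded_poset_segre_power:
  assumes t: "1 \<le> t"
  shows "ascent_graded_poset (segre_power Q t) (segre_ascent t A)"
proof -
  interpret S: finite_graded_poset "segre_power Q t"
    using t by (rule finite_graded_poset_segre_power)
  show ?thesis
  proof
    fix x y assume x: "x \<in> segre_power Q t" and y: "y \<in> segre_power Q t" and "x \<le> y"
    let ?D = "\<Pi>\<^sub>E i\<in>{1..t}. interval_max_chains Q (x i) (y i)"
      and ?C = "interval_max_chains (segre_power Q t) x y"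
    have bij: "bij_betw (component_chains t) ?C ?D"
      by (rule bij_betw_component_chains[OF t x y])
    have ex1: "\<exists>!c. c \<in> interval_max_chains Q (x i) (y i) \<and> chain_Des A c = {}" if "i \<in> {1..t}" for i
      using ex1_ascending[OF segre_power_apply[OF x that] segre_power_apply[OF y that]] \<open>x \<le> y\<close>
      by (simp add: le_funD)
    then obtain e where e: "\<And>i. i \<in> {1..t} \<Longrightarrow> e i \<in> interval_max_chains Q (x i) (y i) \<and> chain_Des A (e i) = {}"
      by metis
    then have "restrict e {1..t} \<in> ?D" by auto
    then have "restrict e {1..t} \<in> component_chains t ` ?C"
      using bij by (simp only: bij_betw_def)
    then obtain c where c: "c \<in> ?C" "component_chains t c = restrict e {1..t}"
      by (metis imageE)
    show "\<exists>!c. c \<in> ?C \<and> chain_Des (segre_ascent t A) c = {}"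
    proof (rule ex1I[of _ c])
      show "c \<in> ?C \<and> chain_Des (segre_ascent t A) c = {}"
        using c e by (auto simp: chain_Des_segre_ascent)
    next
      fix d assume d: "d \<in> ?C \<and> chain_Des (segre_ascent t A) d = {}"
      then have dD: "component_chains t d \<in> ?D" using bij by (auto simp: bij_betw_def)
      have "component_chains t d = restrict e {1..t}"
      proof (rule PiE_ext[OF dD \<open>restrict e {1..t} \<in> ?D\<close>])
        fix i assume i: "i \<in> {1..t}"
        have "component_chains t d i \<in> interval_max_chains Q (x i) (y i)" using dD i by auto
        moreover have "chain_Des A (component_chains t d i) = {}"
          using d i by (auto simp: chain_Des_segre_ascent)
        ultimately show "component_chains t d i = restrict e {1..t} i"
          using ex1[OF i] e[OF i] i by auto
      qed
      then have "component_chains t d = component_chains t c" using c by simp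
      then show "d = c"
        using bij c d by (metis bij_betw_imp_inj_on inj_onD)
    qed
  qed
qed

section \<open>Label words and their descents\<close>

lemma length_label_word [simp]: "length (label_word lam c) = length c - 1"
  by (simp add: label_word_def)

lemma nth_label_word: "Suc i < length c \<Longrightarrow> label_word lam c ! i = lam (c ! i, c ! Suc i)"
  by (simp add: label_word_def nth_tl)

definition label_ascent :: "('a \<times> 'a \<Rightarrow> 'l::order) \<Rightarrow> 'a \<Rightarrow> 'a \<Rightarrow> 'a \<Rightarrow> bool" where
  "label_ascent lam x y z \<longleftrightarrow> lam (x, y) < lam (y, z)"

text \<open>The edges into and out of \<open>c ! i\<close> carry the letters with list indices
  \<open>i - 1\<close> and \<open>i\<close>. These are the letters compared at position
  \<open>i\<close> of a word counted from 1, so the two conventions agree without a shift.\<close>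

lemma chain_Des_label_ascent: "chain_Des (label_ascent lam) c = Des (label_word lam c)"
proof -
  have "label_ascent lam (c ! (i - 1)) (c ! i) (c ! Suc i) \<longleftrightarrow>
      label_word lam c ! (i - 1) < label_word lam c ! i" if "i \<in> {1..<length c - 1}" for i
  proof -
    have "Suc (i - 1) = i" "i < length c" "Suc i < length c" using that by auto
    then show ?thesis
      using nth_label_word[of "i - 1" c lam] nth_label_word[of i c lam]
      by (simp add: label_ascent_def)
  qed
  moreover have "i \<in> {1..<length c - 1} \<longleftrightarrow> i \<in> {1..length (label_word lam c) - 1}" for i
    by (simp, linarith)
  ultimately show ?thesis
    unfolding chain_Des_def Des_def Asc_def by blast
qed

text \<open>Comparing neighbours suffices by transitivity. This links the increasing chains of an
  EL-labeling to chains without descents.\<close>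

lemma Des_empty_iff: "Des w = {} \<longleftrightarrow> sorted_wrt (<) w"
proof -
  have "Des w = {} \<longleftrightarrow> (\<forall>i\<in>{1..length w - 1}. w ! (i - 1) < w ! i)"
    by (auto simp: Des_def Asc_def)
  also have "\<dots> \<longleftrightarrow> (\<forall>i. Suc i < length w \<longrightarrow> w ! i < w ! Suc i)"
  proof (intro iffI allI impI ballI)
    fix i assume "\<forall>i\<in>{1..length w - 1}. w ! (i - 1) < w ! i" "Suc i < length w"
    then show "w ! i < w ! Suc i" by (auto dest!: bspec[of _ _ "Suc i"])
  next
    fix i assume "\<forall>i. Suc i < length w \<longrightarrow> w ! i < w ! Suc i" "i \<in> {1..length w - 1}"
    then show "w ! (i - 1) < w ! i" by (cases i) auto
  qed
  also have "\<dots> \<longleftrightarrow> sorted_wrt (<) w"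
    by (simp add: successively_conv_nth flip: successively_conv_sorted_wrt)
  finally show ?thesis .
qed

section \<open>From chain counts to sums over words\<close>

lemma infsum_card_fibres:
  assumes "finite C" "f ` C \<subseteq> W"
  shows "(\<Sum>\<^sub>\<infinity>w\<in>{w \<in> W. R w}. real (card {c \<in> C. f c = w})) = real (card {c \<in> C. R (f c)})"
proof -
  let ?C = "{c \<in> C. R (f c)}"
  have "(\<Sum>\<^sub>\<infinity>w\<in>{w \<in> W. R w}. real (card {c \<in> C. f c = w})) =
      (\<Sum>\<^sub>\<infinity>w\<in>f ` ?C. real (card {c \<in> ?C. f c = w}))"
  \<comment> \<open>Words outside the image have empty fibres and contribute 0, so the possibly
    infinite sum reduces to a finite one over the image.\<close>
  proof (rule infsum_cong_neutral)
    fix w assume "w \<in> {w \<in> W. R w} - f ` ?C"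
    then have "{c \<in> C. f c = w} = {}" by auto
    then show "real (card {c \<in> C. f c = w}) = 0" by (simp only: card.empty of_nat_0)
  next
    fix w assume "w \<in> {w \<in> W. R w} \<inter> f ` ?C"
    then have "{c \<in> C. f c = w} = {c \<in> ?C. f c = w}" by auto
    then show "real (card {c \<in> C. f c = w}) = real (card {c \<in> ?C. f c = w})" by (simp only:)
  qed (use assms in auto)
  also have "\<dots> = (\<Sum>w\<in>f ` ?C. \<Sum>c\<in>{c \<in> ?C. f c = w}. 1)"
    using assms by simp
  also have "\<dots> = (\<Sum>c\<in>?C. 1)"
    using assms by (intro sum.group) auto
  finally show ?thesis by simp
qed

text \<open>A product of fibre sizes is the size of the product of the fibres. Extensionality of
  \<open>ws\<close> reduces equality of tuples to equality on \<open>{1..t}\<close>.\<close>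

lemma prod_el_eq_card:
  fixes t :: nat
  assumes "ws \<in> extensional {1..t}"
  shows "(\<Prod>i=1..t. real (el P lam (ws i))) =
    real (card {cs \<in> {1..t} \<rightarrow>\<^sub>E max_chains P. (\<lambda>i\<in>{1..t}. label_word lam (cs i)) = ws})"
proof -
  have "(\<lambda>i\<in>{1..t}. label_word lam (cs i)) = ws \<longleftrightarrow> (\<forall>i\<in>{1..t}. label_word lam (cs i) = ws i)" for cs
    using assms by (auto intro: extensionalityI)
  then have "{cs \<in> {1..t} \<rightarrow>\<^sub>E max_chains P. (\<lambda>i\<in>{1..t}. label_word lam (cs i)) = ws} =
      (\<Pi>\<^sub>E i\<in>{1..t}. {c \<in> max_chains P. label_word lam c = ws i})"
    by (auto simp: PiE_def Pi_def)
  then show ?thesis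
    by (simp only: card_PiE finite_atLeastAtMost of_nat_prod el_def)
qed

theorem theorem2p8:
  fixes P :: "'a::order set" and L :: "'l::order set"
    and lam :: "'a \<times> 'a \<Rightarrow> 'l" and n t :: nat
  assumes "finite P" and "bounded_poset P" and "graded_poset P"
    and "poset_rank P = n" and "n \<ge> 1"
    and "EL_labeling P L lam"
    and "t \<ge> 1"
  shows
    "(\<forall>J \<subseteq> {1..n - 1}.
        (-1) powi (int (card J) - 1) * real_of_int (mu (rank_selected P J)) =
        (\<Sum>\<^sub>\<infinity>w\<in>{w \<in> words n L. Des w = J}. real (el P lam w))) \<and>
     (-1) powi (int n - 2) * real_of_int (mu P) =
        (\<Sum>\<^sub>\<infinity>w\<in>{w \<in> words n L. Des w = {1..n - 1}}. real (el P lam w)) \<and>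
     (\<forall>J \<subseteq> {1..n - 1}.
        (-1) powi (int (card J) - 1) * real_of_int (mu (rank_selected (segre_power P t) J)) =
        (\<Sum>\<^sub>\<infinity>ws\<in>{ws \<in> {1..t} \<rightarrow>\<^sub>E words n L. Des_tuple n t ws = J}.
           \<Prod>i=1..t. real (el P lam (ws i)))) \<and>
     (-1) powi (int n - 2) * real_of_int (mu (segre_power P t)) =
        (\<Sum>\<^sub>\<infinity>ws\<in>{ws \<in> {1..t} \<rightarrow>\<^sub>E words n L. (\<Inter>i\<in>{1..t}. Asc (ws i)) = {}}.
           \<Prod>i=1..t. real (el P lam (ws i)))"
proof -
  interpret P: ascent_graded_poset P "label_ascent lam"
  proof
    fix x y assume "x \<in> P" "y \<in> P" "x \<le> y"
    then show "\<exists>!c. c \<in> interval_max_chains P x y \<and> chain_Des (label_ascent lam) c = {}"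
      using assms(6) by (auto simp: EL_labeling_def chain_Des_label_ascent Des_empty_iff)
  qed (use assms in auto)
  interpret S: ascent_graded_poset "segre_power P t" "segre_ascent t (label_ascent lam)"
    by (rule P.ascent_graded_poset_segre_power[OF \<open>t \<ge> 1\<close>])
  have rank_S: "poset_rank (segre_power P t) = n"
    using P.poset_rank_segre_power[OF \<open>t \<ge> 1\<close>] assms(4) by simp
  have fin: "finite (max_chains P)"
    using assms(1) by (simp add: max_chains_def finite_interval_max_chains)
  \<comment> \<open>Every maximal chain has \<open>n\<close> steps with labels in \<open>L\<close>,
    so summing over \<open>words n L\<close> misses no chain.\<close>
  have word: "label_word lam c \<in> words n L" if c: "c \<in> max_chains P" for c
  proof -
    have "length c = Suc n"
      using P.length_chain_from_zero c assms(4) by (simp add: max_chains_def poset_rank_def)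
    moreover have "lam (c ! i, c ! Suc i) \<in> L" if "Suc i < length c" for i
      using that c assms(6)
      by (auto simp: max_chains_def interval_max_chains_iff_nth EL_labeling_def cover_relations_def Pi_def)
    ultimately show ?thesis
      by (auto simp: words_def in_set_conv_nth nth_label_word)
  qed
  have words_sum: "(\<Sum>\<^sub>\<infinity>w\<in>{w \<in> words n L. Des w = J}. real (el P lam w)) =
      real (card {c \<in> max_chains P. chain_Des (label_ascent lam) c = J})" for J
    using infsum_card_fibres[OF fin, of "label_word lam" "words n L" "\<lambda>w. Des w = J"] word
    by (auto simp: el_def chain_Des_label_ascent)
  \<comment> \<open>All words have length \<open>n\<close>, so their descent sets are complements in
    the same set and De Morgan applies.\<close>
  have Des_tuple_eq: "Des_tuple n t ws = (\<Union>i\<in>{1..t}. Des (ws i))"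
    if "ws \<in> {1..t} \<rightarrow>\<^sub>E words n L" for ws
  proof -
    have "length (ws i) = n" if "i \<in> {1..t}" for i
      using that \<open>ws \<in> _\<close> by (auto simp: words_def PiE_def Pi_def)
    then show ?thesis by (auto simp: Des_tuple_def Des_def)
  qed
  have tuples_sum: "(\<Sum>\<^sub>\<infinity>ws\<in>{ws \<in> {1..t} \<rightarrow>\<^sub>E words n L. Des_tuple n t ws = J}.
         \<Prod>i=1..t. real (el P lam (ws i))) =
      real (card {c \<in> max_chains (segre_power P t). chain_Des (segre_ascent t (label_ascent lam)) c = J})"
    for J
  proof -
    let ?C = "{1..t} \<rightarrow>\<^sub>E max_chains P" and ?W = "{1..t} \<rightarrow>\<^sub>E words n L"
    let ?f = "\<lambda>cs. \<lambda>i\<in>{1..t}. label_word lam (cs i)"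
    have tuple_word: "?f cs \<in> ?W" if cs: "cs \<in> ?C" for cs
      by (rule restrict_PiE_iff[THEN iffD2], rule ballI, rule word) (rule PiE_mem[OF cs])
    have "(\<Sum>\<^sub>\<infinity>ws\<in>{ws \<in> ?W. Des_tuple n t ws = J}. \<Prod>i=1..t. real (el P lam (ws i))) =
        (\<Sum>\<^sub>\<infinity>ws\<in>{ws \<in> ?W. Des_tuple n t ws = J}. real (card {cs \<in> ?C. ?f cs = ws}))"
      by (intro infsum_cong prod_el_eq_card) (auto simp: PiE_def)
    also have "\<dots> = real (card {cs \<in> ?C. Des_tuple n t (?f cs) = J})"
    proof (rule infsum_card_fibres)
      show "finite ?C" using fin by (simp add: finite_PiE)
      show "?f ` ?C \<subseteq> ?W" using tuple_word by (rule image_subsetI)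
    qed
    also have "{cs \<in> ?C. Des_tuple n t (?f cs) = J} =
        {cs \<in> ?C. (\<Union>i\<in>{1..t}. chain_Des (label_ascent lam) (cs i)) = J}"
    proof (rule Collect_cong, rule conj_cong)
      fix cs assume "cs \<in> ?C"
      then have "?f cs \<in> ?W" by (rule tuple_word)
      then have "Des_tuple n t (?f cs) = (\<Union>i\<in>{1..t}. chain_Des (label_ascent lam) (cs i))"
        by (simp add: Des_tuple_eq chain_Des_label_ascent)
      then show "Des_tuple n t (?f cs) = J \<longleftrightarrow>
          (\<Union>i\<in>{1..t}. chain_Des (label_ascent lam) (cs i)) = J" by simp
    qed simp
    also have "card \<dots> = card {c \<in> max_chains (segre_power P t).
        chain_Des (segre_ascent t (label_ascent lam)) c = J}"
      by (rule P.card_segre_power_max_chains[OF \<open>t \<ge> 1\<close>, symmetric])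
    finally show ?thesis .
  qed
  \<comment> \<open>As \<open>t \<ge> 1\<close>, the common ascents form a subset of
    \<open>{1..n - 1}\<close>, so their complement is everything exactly when there are
    none.\<close>
  have no_common_ascent: "{ws \<in> {1..t} \<rightarrow>\<^sub>E words n L. (\<Inter>i\<in>{1..t}. Asc (ws i)) = {}} =
      {ws \<in> {1..t} \<rightarrow>\<^sub>E words n L. Des_tuple n t ws = {1..n - 1}}"
  proof (rule Collect_cong, rule conj_cong)
    fix ws assume ws: "ws \<in> {1..t} \<rightarrow>\<^sub>E words n L"
    have 1: "1 \<in> {1..t}" using \<open>t \<ge> 1\<close> by simp
    then have "length (ws 1) = n" using ws by (auto simp: words_def PiE_def Pi_def)
    then have "(\<Inter>i\<in>{1..t}. Asc (ws i)) \<subseteq> {1..n - 1}" using 1 by (auto simp: Asc_def)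
    then show "(\<Inter>i\<in>{1..t}. Asc (ws i)) = {} \<longleftrightarrow> Des_tuple n t ws = {1..n - 1}"
      unfolding Des_tuple_def by blast
  qed simp
  show ?thesis
    unfolding no_common_ascent words_sum tuples_sum
    using P.real_mu_rank_selected P.real_mu S.real_mu_rank_selected S.real_mu assms(4,5)
    unfolding rank_S by auto
qed

end
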